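(* Let $\theta$ and $\vartheta$ be random variables (defined jointly) with values in the unit circle $S^1$, and let $P(x_1,x_2)=\sum_{k_1,k_2=0}^{\infty}b_{k_1,k_2}x_1^{k_1}x_2^{k_2}$ be a polynomial with complex coefficients. Put $\alpha_{k_1,k_2}:=\mathbb{E}[\theta^{k_1}\vartheta^{k_2}]$. Then for every $n$, $$\mathbb{E}_n\left[W^1(P)(x_1,x_2)\right]=\left[\prod_{k_1,k_2=0}^{\infty}(1-x_1^{k_1}x_2^{k_2}t)^{-b_{k_1,k_2}\alpha_{k_1,k_2}}\right]_n,$$ $$\mathbb{E}_n\left[W^2(P)(x_1,x_2)\right]=\left[\prod_{k_1,k_2=0}^{\infty}(1-\alpha_{k_1,k_2}x_1^{k_1}x_2^{k_2}t)^{-b_{k_1,k_2}}\right]_n.$$ These identities hold with the (finite) products expanded as formal power series in $t$. Moreover the two products are holomorphic for $|t|<1$ and $\max\{|x_1|,|x_2|\}\le 1$ (that is, holomorphic in $t$ on $|t|<1$ for each fixed $(x_1,x_2)$ with $\max\{|x_1|,|x_2|\}\le 1$, and jointly holomorphic in $(x_1,x_2,t)$ in the interior of this region).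
   Context: $\mathcal{S}_n$ is the group of permutations of $\{1,\dots,n\}$; $\mathcal{C}_\lambda\subset\mathcal{S}_n$ is the set of permutations with cycle-type the partition $\lambda=(\lambda_1,\dots,\lambda_{l(\lambda)})$ of $n$ (the $\lambda_m\geq 1$ are the cycle lengths, $l(\lambda)$ is the number of cycles). For a power series $h(t)=\sum_n h_nt^n$ write $[h(t)]_n:=h_n$. Complex powers $z^s$ are defined with the principal branch of the logarithm on $\mathbb{C}\setminus\mathbb{R}_{\le 0}$. First randomized class function: for $g\in\mathcal{C}_\lambda$, $W^1(P)(x_1,x_2)(g):=\prod_{m=1}^{l(\lambda)}P(\theta_mx_1^{\lambda_m},\vartheta_mx_2^{\lambda_m})$, where the pairs $(\theta_m,\vartheta_m)$ are iid, distributed as $(\theta,\vartheta)$, and independent of $g$ (one pair per cycle). Second randomized class function: for $g\in\mathcal{C}_\lambda$, $W^2(P)(x_1,x_2)(g):=\prod_{m=1}^{l(\lambda)}P\big(x_1^{\lambda_m}\prod_{i=1}^{\lambda_m}\theta_i^{(m)},\,x_2^{\lambda_m}\prod_{i=1}^{\lambda_m}\vartheta_i^{(m)}\big)$, where the $n$ pairs $(\theta_i^{(m)},\vartheta_i^{(m)})$ are iid, distributed as $(\theta,\vartheta)$, and independent of $g$ (one pair per point). $\mathbb{E}_n[\cdot]$ denotes expectation over $g$ uniformly distributed on $\mathcal{S}_n$ and over the auxiliary random variables. *)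

theory Defs
  imports
    "HOL-Probability.Probability"
    "HOL-Complex_Analysis.Complex_Analysis"
    "HOL-Combinatorics.Orbits"
begin

abbreviation Sym :: "nat \<Rightarrow> (nat \<Rightarrow> nat) set" where
  "Sym n \<equiv> {g. g permutes {1..n}}"

definition cycle_type :: "nat \<Rightarrow> (nat \<Rightarrow> nat) \<Rightarrow> nat list" where
  "cycle_type n g = rev (sorted_list_of_multiset (image_mset card (mset_set (orbit g ` {1..n}))))"

text \<open>A polynomial in two variables is given by its coefficients \<open>b k1 k2\<close>, which vanish
  outside a finite set.\<close>

definition coeff_supp :: "(nat \<Rightarrow> nat \<Rightarrow> complex) \<Rightarrow> (nat \<times> nat) set" where
  "coeff_supp b = {(k1, k2). b k1 k2 \<noteq> 0}"

definition bpoly :: "(nat \<Rightarrow> nat \<Rightarrow> complex) \<Rightarrow> complex \<Rightarrow> complex \<Rightarrow> complex" where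
  "bpoly b x1 x2 = (\<Sum>(k1, k2)\<in>coeff_supp b. b k1 k2 * x1 ^ k1 * x2 ^ k2)"

text \<open>The argument \<open>z\<close> is a realization of the auxiliary pairs.  Cycles, and the positions inside
  a cycle, are numbered from 0, so \<open>z m\<close> is the pair of the cycle of length \<open>cycle_type n g ! m\<close>,
  and \<open>z (m, i)\<close> that of the \<open>i\<close>-th position in this cycle.  Only the \<open>n\<close> entries \<open>z (m, i)\<close> with
  \<open>i < cycle_type n g ! m\<close> occur in \<open>W2\<close>.\<close>

definition W1 :: "(nat \<Rightarrow> nat \<Rightarrow> complex) \<Rightarrow> complex \<Rightarrow> complex \<Rightarrow> nat \<Rightarrow>
    (nat \<Rightarrow> nat) \<Rightarrow> (nat \<Rightarrow> complex \<times> complex) \<Rightarrow> complex" where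
  "W1 b x1 x2 n g z = (let l = cycle_type n g in
     \<Prod>m<length l. bpoly b (fst (z m) * x1 ^ (l ! m)) (snd (z m) * x2 ^ (l ! m)))"

definition W2 :: "(nat \<Rightarrow> nat \<Rightarrow> complex) \<Rightarrow> complex \<Rightarrow> complex \<Rightarrow> nat \<Rightarrow>
    (nat \<Rightarrow> nat) \<Rightarrow> (nat \<times> nat \<Rightarrow> complex \<times> complex) \<Rightarrow> complex" where
  "W2 b x1 x2 n g z = (let l = cycle_type n g in
     \<Prod>m<length l. bpoly b (x1 ^ (l ! m) * (\<Prod>i<l ! m. fst (z (m, i))))
                           (x2 ^ (l ! m) * (\<Prod>i<l ! m. snd (z (m, i)))))"

text \<open>On the probability space \<open>\<Omega>\<close>, \<open>G\<close> is a uniformly distributed permutation, \<open>(Z i)\<close> for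
  \<open>i \<in> I\<close> are iid pairs with law \<open>\<mu>\<close>, and \<open>G\<close> is independent of the whole family \<open>Z\<close>.\<close>

definition uniform_perm_iid_pairs :: "nat \<Rightarrow> 'i set \<Rightarrow> (complex \<times> complex) measure \<Rightarrow> 'a measure \<Rightarrow>
    ('a \<Rightarrow> nat \<Rightarrow> nat) \<Rightarrow> ('i \<Rightarrow> 'a \<Rightarrow> complex \<times> complex) \<Rightarrow> bool" where
  "uniform_perm_iid_pairs n I \<mu> \<Omega> G Z \<longleftrightarrow>
     prob_space \<Omega> \<and>
     G \<in> measurable \<Omega> (count_space (Sym n)) \<and>
     distr \<Omega> (count_space (Sym n)) G = uniform_count_measure (Sym n) \<and>
     prob_space.indep_vars \<Omega> (\<lambda>_. borel) Z I \<and>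
     (\<forall>i\<in>I. distr \<Omega> borel (Z i) = \<mu>) \<and>
     prob_space.indep_set \<Omega>
       (sets (vimage_algebra (space \<Omega>) G (count_space (Sym n))))
       (sets (vimage_algebra (space \<Omega>) (\<lambda>\<omega>. \<lambda>i\<in>I. Z i \<omega>) (Pi\<^sub>M I (\<lambda>_. borel))))"

text \<open>The formal power series \<open>(1 - c t)\<close> to the power \<open>s\<close>.\<close>

definition fps_one_minus_powr :: "complex \<Rightarrow> complex \<Rightarrow> complex fps" where
  "fps_one_minus_powr c s = fps_binomial s oo (fps_const (- c) * fps_X)"

lemma has_fps_expansion_one_minus_powr:
  "(\<lambda>t. (1 - c * t) powr s) has_fps_expansion fps_one_minus_powr c s"
proof -
  have c: "(\<lambda>t. - c * t) has_fps_expansion fps_const (- c) * fps_X"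
    by (intro fps_expansion_intros)
  have b: "(\<lambda>u::complex. (1 + u) powr s) has_fps_expansion fps_binomial s"
    by (rule has_fps_expansion_binomial_complex)
  have "((\<lambda>u. (1 + u) powr s) \<circ> (\<lambda>t. - c * t)) has_fps_expansion
          (fps_binomial s oo (fps_const (- c) * fps_X))"
    by (rule has_fps_expansion_compose[OF b c]) simp
  thus ?thesis
    by (simp add: fps_one_minus_powr_def o_def)
qed

text \<open>Joint holomorphy (meant for open \<open>S\<close>): the Frechet derivative exists and is complex linear.\<close>

definition holomorphic3_on :: "(complex \<times> complex \<times> complex \<Rightarrow> complex) \<Rightarrow>
    (complex \<times> complex \<times> complex) set \<Rightarrow> bool" where
  "holomorphic3_on f S \<longleftrightarrow> (\<forall>z\<in>S. \<exists>a b c.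
     (f has_derivative (\<lambda>(u, v, w). a * u + b * v + c * w)) (at z within S))"

end

theory Submission
  imports Defs
begin

text \<open>
  Once the permutation \<open>g\<close> is held constant, the factors of different cycles are independent in both
  randomizations, so the expectation of the class function at \<open>g\<close> is the product over the cycles
  of the expected factor of one cycle.  Expanding the polynomial, the expected factor of a
  cycle of length \<open>j\<close> is

    \<^item> \<open>\<Sum>k1 k2. b k1 k2 * \<alpha> k1 k2 * (x1 ^ k1 * x2 ^ k2) ^ j\<close> with one pair for each cycle,
    \<^item> \<open>\<Sum>k1 k2. b k1 k2 * (\<alpha> k1 k2 * x1 ^ k1 * x2 ^ k2) ^ j\<close> with one pair for each point.

  Both have the form \<open>f j = (\<Sum>i\<in>A. s i * c i ^ j)\<close>, a combination of geometric sequences, and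
  \<open>expectation_random_cycle_product\<close> treats them together.  It remains to average
  \<open>\<Prod>\<^sub>C f (card C)\<close>, a product over the cycles \<open>C\<close> of a permutation, over all permutations.

  This average is computed without counting conjugacy classes.  By \<open>sum_cycle_weight\<close>, the
  average \<open>h\<^sub>n\<close> satisfies \<open>n h\<^sub>n = f\<^sub>1 h\<^bsub>n-1\<^esub> + \<dots> + f\<^sub>n h\<^sub>0\<close>, as one sees by removing the points of the
  cycle of a marked point one after the other.  The coefficients of \<open>\<Prod>i\<in>A. (1 - c i * t)\<^bsup>-s i\<^esup>\<close>
  satisfy the same recurrence, because its logarithmic derivative is
  \<open>\<Sum>i\<in>A. s i * c i / (1 - c i * t)\<close>, whose coefficients are \<open>f 1, f 2, \<dots>\<close>.

  For the holomorphy, the moments satisfy \<open>norm (\<alpha> k1 k2) \<le> 1\<close>, so all bases of the powers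
  have the form \<open>1 - z\<close> with \<open>norm z < 1\<close> and avoid the branch cut.
\<close>

section \<open>Sums over permutations by cycle lengths\<close>

text \<open>The product of the weights \<open>f\<close> of the cycle lengths of a permutation \<open>p\<close> of \<open>S\<close>; fixed
  points count as cycles of length one.\<close>

definition cycle_weight :: "(nat \<Rightarrow> 'b::comm_monoid_mult) \<Rightarrow> 'a set \<Rightarrow> ('a \<Rightarrow> 'a) \<Rightarrow> 'b" where
  "cycle_weight f S p = (\<Prod>C\<in>orbit p ` S. f (card C))"

text \<open>The same product, except that the cycle through the marked point \<open>a\<close> has a weight \<open>g\<close> of
  its own.\<close>

definition marked_cycle_weight ::
    "(nat \<Rightarrow> 'b::comm_monoid_mult) \<Rightarrow> (nat \<Rightarrow> 'b) \<Rightarrow> 'a set \<Rightarrow> 'a \<Rightarrow> ('a \<Rightarrow> 'a) \<Rightarrow> 'b" where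
  "marked_cycle_weight f g S a p =
     g (card (orbit p a)) * (\<Prod>C\<in>orbit p ` S - {orbit p a}. f (card C))"

lemma marked_cycle_weight_same:
  assumes "finite S" "a \<in> S"
  shows "marked_cycle_weight f f S a p = cycle_weight f S p"
  unfolding marked_cycle_weight_def cycle_weight_def
  using assms by (subst (2) prod.remove[of _ "orbit p a"]) auto

lemma self_in_orbit_permutes:
  assumes "finite S" "p permutes S"
  shows "x \<in> orbit p x"
  using assms by (intro permutation_self_in_orbit) (auto simp: permutation_permutes)

lemma orbit_eq_permutes:
  assumes "finite S" "p permutes S" "y \<in> orbit p x"
  shows "orbit p y = orbit p x"
  using cyclic_on_orbit[OF assms(2,1)] assms(3) by (rule orbit_cyclic_eq3)

text \<open>Composing with the transposition of \<open>b\<close> and a new point \<open>a\<close> inserts \<open>a\<close> in front of \<open>b\<close>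
  into the cycle of \<open>b\<close> and leaves the other cycles alone.\<close>

context
  fixes S :: "'a set" and p q :: "'a \<Rightarrow> 'a" and a b :: 'a
  assumes fin: "finite S" and p: "p permutes S" and a: "a \<notin> S" and b: "b \<in> S"
  defines "q \<equiv> Transposition.transpose a b \<circ> p"
begin

lemma transpose_comp_permutes_insert: "q permutes insert a S"
proof -
  have "Transposition.transpose a b permutes insert a S"
    using b by (intro permutes_swap_id) auto
  moreover have "p permutes insert a S"
    using p by (rule permutes_subset) auto
  ultimately show ?thesis
    unfolding q_def by (intro permutes_compose)
qed

lemma transpose_comp_apply:
  "q a = b" "x \<in> S \<Longrightarrow> q x = (if p x = b then a else p x)"
proof -
  show "q a = b"
    using p a by (simp add: q_def permutes_not_in)
  assume "x \<in> S"
  hence "p x \<noteq> a"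
    using p a permutes_in_image[of p S x] by metis
  thus "q x = (if p x = b then a else p x)"
    by (simp add: q_def Transposition.transpose_def)
qed

lemma orbit_transpose_comp_new: "orbit q a = insert a (orbit p b)"
proof (intro equalityI subsetI)
  have sub: "orbit p b \<subseteq> S"
    using p b by (rule permutes_orbit_subset)
  fix y assume "y \<in> orbit q a"
  thus "y \<in> insert a (orbit p b)"
  proof induction
    case base
    show ?case
      using self_in_orbit_permutes[OF fin p, of b] by (simp add: transpose_comp_apply)
  next
    case (step y)
    show ?case
    proof (cases "y = a")
      case True
      thus ?thesis
        using self_in_orbit_permutes[OF fin p, of b] by (simp add: transpose_comp_apply)
    next
      case False
      hence "y \<in> orbit p b" "y \<in> S"
        using step sub by auto
      thus ?thesis
        using transpose_comp_apply(2)[of y] by (auto intro: orbit.step)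
    qed
  qed
next
  have qa: "a \<in> orbit q a"
    using fin transpose_comp_permutes_insert by (intro self_in_orbit_permutes[of "insert a S"]) auto
  have bq: "b \<in> orbit q a"
    using orbit.base[of q a] by (simp add: transpose_comp_apply)
  have image: "p y \<in> orbit q a" if "y \<in> orbit q a" "y \<in> S" for y
    using orbit.step[OF that(1)] transpose_comp_apply(2)[OF that(2)] bq
    by (cases "p y = b") auto
  have "y \<in> orbit q a \<and> y \<in> S" if "y \<in> orbit p b" for y
    using that
  proof induction
    case base
    show ?case
      using image[OF bq b] b permutes_in_image[OF p, of b] by blast
  next
    case (step y)
    thus ?case
      using image[of y] permutes_in_image[OF p, of y] by blast
  qed
  moreover fix y assume "y \<in> insert a (orbit p b)"
  ultimately show "y \<in> orbit q a"
    using qa by auto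
qed

lemma orbit_transpose_comp_old:
  assumes x: "x \<in> S" "x \<notin> orbit p b"
  shows "orbit q x = orbit p x"
proof (rule orbit_cong)
  show "x \<in> orbit p x"
    using fin p by (rule self_in_orbit_permutes)
next
  fix s assume s: "s \<in> orbit p x"
  hence "p s \<in> orbit p x"
    by (rule orbit.step)
  hence "p s \<noteq> b"
    using x orbit_eq_permutes[OF fin p, of b x] self_in_orbit_permutes[OF fin p, of x] by metis
  moreover have "s \<in> S"
    using permutes_orbit_subset[OF p x(1)] s by auto
  ultimately show "q s = p s"
    using transpose_comp_apply(2) by auto
qed

lemma orbits_transpose_comp:
  "orbit q ` insert a S - {orbit q a} = orbit p ` S - {orbit p b}"
proof -
  have self: "x \<in> orbit p x" for x
    using fin p by (rule self_in_orbit_permutes)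
  have eqq: "orbit q x = orbit q a" if "x \<in> orbit p b" for x
    using fin that transpose_comp_permutes_insert
    by (intro orbit_eq_permutes[of "insert a S"]) (auto simp: orbit_transpose_comp_new)
  have eqp: "orbit p x = orbit p b" if "x \<in> orbit p b" for x
    using fin p that by (rule orbit_eq_permutes)
  have neq: "orbit q x \<noteq> orbit q a" "orbit p x \<noteq> orbit p b" "orbit q x = orbit p x"
    if "x \<in> S" "x \<notin> orbit p b" for x
  proof -
    show eq: "orbit q x = orbit p x"
      using that by (rule orbit_transpose_comp_old)
    have "a \<notin> orbit p x"
      using permutes_orbit_subset[OF p that(1)] a by auto
    thus "orbit q x \<noteq> orbit q a"
      unfolding eq orbit_transpose_comp_new by blast
    show "orbit p x \<noteq> orbit p b"
      using self[of x] that(2) by blast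
  qed
  have "orbit q ` insert a S - {orbit q a} = orbit q ` (S - orbit p b)"
  proof (intro equalityI subsetI)
    fix C assume "C \<in> orbit q ` insert a S - {orbit q a}"
    then obtain x where x: "x \<in> insert a S" "C = orbit q x" "orbit q x \<noteq> orbit q a"
      by blast
    hence "x \<in> S - orbit p b"
      using eqq[of x] by blast
    thus "C \<in> orbit q ` (S - orbit p b)"
      using x(2) by blast
  next
    fix C assume "C \<in> orbit q ` (S - orbit p b)"
    thus "C \<in> orbit q ` insert a S - {orbit q a}"
      using neq(1) by blast
  qed
  also have "\<dots> = orbit p ` (S - orbit p b)"
    using neq(3) by (intro image_cong) auto
  also have "\<dots> = orbit p ` S - {orbit p b}"
  proof (intro equalityI subsetI)
    fix C assume "C \<in> orbit p ` (S - orbit p b)"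
    thus "C \<in> orbit p ` S - {orbit p b}"
      using neq(2) by blast
  next
    fix C assume "C \<in> orbit p ` S - {orbit p b}"
    then obtain x where x: "x \<in> S" "C = orbit p x" "orbit p x \<noteq> orbit p b"
      by blast
    hence "x \<in> S - orbit p b"
      using eqp[of x] by blast
    thus "C \<in> orbit p ` (S - orbit p b)"
      using x(2) by blast
  qed
  finally show ?thesis .
qed

lemma marked_cycle_weight_transpose_comp:
  "marked_cycle_weight f g (insert a S) a q = marked_cycle_weight f (\<lambda>k. g (Suc k)) S b p"
proof -
  have "orbit p b \<subseteq> S"
    using p b by (rule permutes_orbit_subset)
  hence "card (orbit q a) = Suc (card (orbit p b))"
    unfolding orbit_transpose_comp_new using a fin finite_subset by (subst card_insert_disjoint) auto
  thus ?thesis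
    unfolding marked_cycle_weight_def orbits_transpose_comp by simp
qed

end

lemma marked_cycle_weight_fixpoint:
  assumes "finite S" "p permutes S" "a \<notin> S"
  shows "marked_cycle_weight f g (insert a S) a p = g 1 * cycle_weight f S p"
proof -
  have "orbit p a = {a}"
    using assms by (simp add: orbit_eq_singleton_iff permutes_not_in)
  moreover have "{a} \<notin> orbit p ` S"
    using permutes_orbit_subset[OF assms(2)] assms(3) by fastforce
  ultimately show ?thesis
    by (simp add: marked_cycle_weight_def cycle_weight_def)
qed

text \<open>The sum of the cycle weights over all permutations of an \<open>n\<close>-set is \<open>n! h\<^sub>n\<close>, for any \<open>h\<close>
  with \<open>h\<^sub>0 = 1\<close> and \<open>n h\<^sub>n = f\<^sub>1 h\<^bsub>n-1\<^esub> + \<dots> + f\<^sub>n h\<^sub>0\<close>; over a field, \<open>h\<^sub>n\<close> is the coefficient of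
  \<open>t\<^sup>n\<close> in \<open>exp (\<Sum>k\<ge>1. f\<^sub>k t\<^sup>k / k)\<close>.

  The induction needs the marked weights, with an arbitrary weight \<open>g\<close> of the marked cycle:
  removing the marked point \<open>a\<close> either removes a fixed point, or shortens the cycle by one and
  passes the mark on to the successor of \<open>a\<close>, with \<open>g (k + 1)\<close> in place of \<open>g k\<close>.\<close>

lemma sum_cycle_weight:
  fixes f h :: "nat \<Rightarrow> 'b::{comm_semiring_1, semiring_char_0}" and S :: "'a set"
  assumes h0: "h 0 = 1"
    and hSuc: "\<And>n. of_nat (Suc n) * h (Suc n) = (\<Sum>k\<le>n. f (Suc k) * h (n - k))"
    and S: "finite S" "card S = n"
  shows "(\<Sum>p | p permutes S. cycle_weight f S p) = fact n * h n"
proof -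
  have "(\<Sum>p | p permutes S. cycle_weight f S p) = fact n * h n \<and>
        (\<forall>m a g. n = Suc m \<longrightarrow> a \<in> S \<longrightarrow>
          (\<Sum>p | p permutes S. marked_cycle_weight f g S a p) =
            fact m * (\<Sum>k\<le>m. g (Suc k) * h (m - k)))"
    using S
  proof (induction n arbitrary: S)
    case 0
    thus ?case by (simp add: cycle_weight_def h0)
  next
    case (Suc n)
    have marked: "(\<Sum>p | p permutes S. marked_cycle_weight f g S a p) =
        fact n * (\<Sum>k\<le>n. g (Suc k) * h (n - k))" if "a \<in> S" for a g
    proof -
      define S' where "S' = S - {a}"
      have S': "finite S'" "a \<notin> S'" "card S' = n" and S_eq: "S = insert a S'"
        using Suc.prems that by (auto simp: S'_def)
      note IH = Suc.IH[OF S'(1,3)]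
      have "(\<Sum>p | p permutes S. marked_cycle_weight f g S a p) =
          (\<Sum>b\<in>insert a S'. \<Sum>p | p permutes S'. marked_cycle_weight f g S a (Transposition.transpose a b \<circ> p))"
        unfolding S_eq by (rule sum_over_permutations_insert[OF S'(1,2)])
      also have "\<dots> = (\<Sum>p | p permutes S'. marked_cycle_weight f g S a p) +
          (\<Sum>b\<in>S'. \<Sum>p | p permutes S'. marked_cycle_weight f g S a (Transposition.transpose a b \<circ> p))"
        using S' by simp
      also have "(\<Sum>p | p permutes S'. marked_cycle_weight f g S a p) =
          (\<Sum>p | p permutes S'. g 1 * cycle_weight f S' p)"
        unfolding S_eq using S' by (intro sum.cong) (auto simp: marked_cycle_weight_fixpoint)
      also have "\<dots> = g 1 * (fact n * h n)"
        using IH by (simp flip: sum_distrib_left)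
      also have "(\<Sum>b\<in>S'. \<Sum>p | p permutes S'. marked_cycle_weight f g S a (Transposition.transpose a b \<circ> p)) =
          (\<Sum>b\<in>S'. \<Sum>p | p permutes S'. marked_cycle_weight f (\<lambda>k. g (Suc k)) S' b p)"
        unfolding S_eq using S'
        by (intro sum.cong refl) (auto simp: marked_cycle_weight_transpose_comp)
      also have "g 1 * (fact n * h n) + \<dots> = fact n * (\<Sum>k\<le>n. g (Suc k) * h (n - k))"
      proof (cases n)
        case 0
        thus ?thesis using S' by simp
      next
        case (Suc m)
        \<comment> \<open>The inner sums do not depend on \<open>b\<close>, and \<open>S'\<close> has \<open>n = m + 1\<close> elements.\<close>
        have "(\<Sum>b\<in>S'. \<Sum>p | p permutes S'. marked_cycle_weight f (\<lambda>k. g (Suc k)) S' b p) =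
            (\<Sum>b\<in>S'. fact m * (\<Sum>k\<le>m. g (Suc (Suc k)) * h (m - k)))"
          using IH Suc by (intro sum.cong) auto
        also have "\<dots> = fact n * (\<Sum>k\<le>m. g (Suc (Suc k)) * h (m - k))"
          using S' Suc by (simp add: algebra_simps)
        finally show ?thesis
          unfolding Suc by (subst sum.atMost_Suc_shift) (simp add: algebra_simps)
      qed
      finally show ?thesis .
    qed
    obtain a where a: "a \<in> S"
      using Suc.prems by fastforce
    have "(\<Sum>p | p permutes S. cycle_weight f S p) = fact (Suc n) * h (Suc n)"
      using marked[OF a, of f] Suc.prems a hSuc[of n, symmetric]
      by (simp add: marked_cycle_weight_same mult_ac)
    thus ?case
      using marked by simp
  qed
  thus ?thesis ..
qed

lemma prod_cycle_type:
  fixes f :: "nat \<Rightarrow> 'b::comm_monoid_mult"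
  shows "(\<Prod>m<length (cycle_type n g). f (cycle_type n g ! m)) = cycle_weight f {1..n} g"
proof -
  have list: "(\<Prod>m<length l. f (l ! m)) = prod_mset (image_mset f (mset l))" for l
  proof -
    have "(\<Prod>m<length l. f (l ! m)) = prod_list (map f l)"
      by (simp add: prod.list_conv_set_nth atLeast0LessThan)
    also have "\<dots> = prod_mset (image_mset f (mset l))"
      by (simp flip: prod_mset_prod_list)
    finally show ?thesis .
  qed
  have "(\<Prod>m<length (cycle_type n g). f (cycle_type n g ! m)) =
      prod_mset (image_mset f (mset (cycle_type n g)))"
    by (rule list)
  also have "\<dots> = prod_mset (image_mset (\<lambda>C. f (card C)) (mset_set (orbit g ` {1..n})))"
    by (simp add: cycle_type_def multiset.map_comp o_def)
  also have "\<dots> = cycle_weight f {1..n} g"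
    by (simp add: cycle_weight_def prod_unfold_prod_mset)
  finally show ?thesis .
qed

lemma cycle_type_bounds:
  assumes "g permutes {1..n}"
  shows "length (cycle_type n g) \<le> n"
    and "m < length (cycle_type n g) \<Longrightarrow> cycle_type n g ! m \<le> n"
proof -
  show "length (cycle_type n g) \<le> n"
    using card_image_le[of "{1..n}" "orbit g"]
    by (simp add: cycle_type_def flip: size_mset)
  assume "m < length (cycle_type n g)"
  hence "cycle_type n g ! m \<in># mset (cycle_type n g)"
    by simp
  then obtain x where x: "x \<in> {1..n}" "cycle_type n g ! m = card (orbit g x)"
    by (auto simp: cycle_type_def)
  thus "cycle_type n g ! m \<le> n"
    using card_mono[OF _ permutes_orbit_subset[OF assms x(1)]] by simp
qed

section \<open>Logarithmic derivatives of the generating products\<close>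

lemma fps_one_minus_powr_nth:
  "fps_nth (fps_one_minus_powr c s) n = (- c) ^ n * (s gchoose n)"
  unfolding fps_one_minus_powr_def by simp

text \<open>For \<open>F = (1 - c t)\<^bsup>-s\<^esup>\<close> this is \<open>F' / F = s c / (1 - c t)\<close>, with the right-hand side
  expanded as a geometric series.\<close>

lemma fps_deriv_one_minus_powr:
  "fps_deriv (fps_one_minus_powr c (- s)) =
     fps_one_minus_powr c (- s) * Abs_fps (\<lambda>n. s * c ^ Suc n)"
proof -
  let ?F = "fps_one_minus_powr c (- s)" and ?D = "1 - fps_const c * fps_X :: complex fps"
  have "fps_nth (?D * fps_deriv ?F) n = fps_nth (fps_const (s * c) * ?F) n" for n
  proof (cases n)
    case 0
    thus ?thesis
      by (simp add: fps_one_minus_powr_nth algebra_simps)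
  next
    case (Suc k)
    have "of_nat (Suc n) * (- s gchoose Suc n) = (- s - of_nat n) * (- s gchoose n)"
      using gbinomial_mult_1[of "- s" n] by (simp add: algebra_simps)
    hence *: "of_nat (Suc n) * (- c) ^ Suc n * (- s gchoose Suc n) =
        (- c) ^ Suc n * ((- s - of_nat n) * (- s gchoose n))"
      by (simp add: mult_ac)
    have "fps_nth (?D * fps_deriv ?F) n =
        of_nat (Suc n) * (- c) ^ Suc n * (- s gchoose Suc n) - c * (of_nat n * ((- c) ^ n * (- s gchoose n)))"
      by (simp add: Suc left_diff_distrib mult.assoc fps_one_minus_powr_nth)
    also have "\<dots> = fps_nth (fps_const (s * c) * ?F) n"
      unfolding * by (simp add: fps_one_minus_powr_nth algebra_simps)
    finally show ?thesis .
  qed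
  hence "?D * fps_deriv ?F = fps_const (s * c) * ?F"
    by (simp add: fps_eq_iff)
  also have "fps_const (s * c) = ?D * Abs_fps (\<lambda>n. s * c ^ Suc n)"
  proof (rule fps_ext)
    fix n show "fps_nth (fps_const (s * c)) n = fps_nth (?D * Abs_fps (\<lambda>n. s * c ^ Suc n)) n"
      by (cases n) (simp_all add: left_diff_distrib mult.assoc)
  qed
  finally have "?D * fps_deriv ?F = ?D * (?F * Abs_fps (\<lambda>n. s * c ^ Suc n))"
    by (simp add: mult_ac)
  moreover have "?D \<noteq> 0"
    by (rule fps_nonzeroI[of _ 0]) simp
  ultimately show ?thesis
    using mult_left_cancel by blast
qed

lemma fps_deriv_prod_one_minus_powr:
  assumes "finite A"
  shows "fps_deriv (\<Prod>i\<in>A. fps_one_minus_powr (c i) (- s i)) =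
    (\<Prod>i\<in>A. fps_one_minus_powr (c i) (- s i)) * Abs_fps (\<lambda>n. \<Sum>i\<in>A. s i * c i ^ Suc n)"
  using assms
proof (induction rule: finite_induct)
  case empty
  thus ?case by (simp flip: fps_zero_def)
next
  case (insert j A)
  have eq: "Abs_fps (\<lambda>n. \<Sum>i\<in>insert j A. s i * c i ^ Suc n) =
      Abs_fps (\<lambda>n. s j * c j ^ Suc n) + Abs_fps (\<lambda>n. \<Sum>i\<in>A. s i * c i ^ Suc n)"
    using insert by (intro fps_ext) simp
  show ?case
    unfolding eq prod.insert[OF insert.hyps] fps_deriv_mult fps_deriv_one_minus_powr insert.IH
    by (simp only: distrib_left mult_ac add_ac)
qed

text \<open>The coefficients of the product satisfy the recurrence of \<open>sum_cycle_weight\<close>, because its logarithmic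
  derivative has the coefficients \<open>\<Sum>i\<in>A. s i * c i ^ (n + 1)\<close>.\<close>

lemma fps_nth_prod_one_minus_powr:
  fixes c s :: "'i \<Rightarrow> complex"
  assumes "finite A"
  defines "H \<equiv> \<Prod>i\<in>A. fps_one_minus_powr (c i) (- s i)"
  shows "fps_nth H 0 = 1"
    and "of_nat (Suc n) * fps_nth H (Suc n) =
      (\<Sum>k\<le>n. (\<Sum>i\<in>A. s i * c i ^ Suc k) * fps_nth H (n - k))"
proof -
  show "fps_nth H 0 = 1"
    using assms(1) unfolding H_def
    by (induction rule: finite_induct) (simp_all add: fps_one_minus_powr_nth)
  have "of_nat (Suc n) * fps_nth H (Suc n) = fps_nth (fps_deriv H) n"
    by simp
  also have "\<dots> = fps_nth (Abs_fps (\<lambda>n. \<Sum>i\<in>A. s i * c i ^ Suc n) * H) n"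
    unfolding H_def fps_deriv_prod_one_minus_powr[OF assms(1)] by (simp add: mult.commute)
  also have "\<dots> = (\<Sum>k\<le>n. (\<Sum>i\<in>A. s i * c i ^ Suc k) * fps_nth H (n - k))"
    by (simp add: fps_mult_nth atMost_atLeast0)
  finally show "of_nat (Suc n) * fps_nth H (Suc n) =
      (\<Sum>k\<le>n. (\<Sum>i\<in>A. s i * c i ^ Suc k) * fps_nth H (n - k))" .
qed

text \<open>The cycle index formula for weights that are combinations of geometric sequences.\<close>

lemma sum_cycle_type_geometric:
  assumes "finite A"
  shows "(\<Sum>g\<in>Sym n. \<Prod>m<length (cycle_type n g). \<Sum>i\<in>A. s i * c i ^ (cycle_type n g ! m)) =
    fact n * fps_nth (\<Prod>i\<in>A. fps_one_minus_powr (c i) (- s i)) n"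
  unfolding prod_cycle_type[where f = "\<lambda>k. \<Sum>i\<in>A. s i * c i ^ k"]
  by (rule sum_cycle_weight) (use fps_nth_prod_one_minus_powr[OF assms] in auto)

section \<open>Holomorphy of the products\<close>

lemma holomorphic3_onI:
  assumes "\<And>z. z \<in> S \<Longrightarrow> (f has_derivative (\<lambda>(u, v, w). a z * u + b z * v + c z * w)) (at z within S)"
  shows "holomorphic3_on f S"
  using assms unfolding holomorphic3_on_def by blast

lemma holomorphic3_on_const: "holomorphic3_on (\<lambda>_. k) S"
  by (rule holomorphic3_onI[where a = "\<lambda>_. 0" and b = "\<lambda>_. 0" and c = "\<lambda>_. 0"])
     (simp add: case_prod_unfold)

lemma holomorphic3_on_fst: "holomorphic3_on fst S"
  by (rule holomorphic3_onI[where a = "\<lambda>_. 1" and b = "\<lambda>_. 0" and c = "\<lambda>_. 0"])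
     (auto simp: case_prod_unfold intro!: derivative_eq_intros)

lemma holomorphic3_on_fst_snd: "holomorphic3_on (\<lambda>z. fst (snd z)) S"
  by (rule holomorphic3_onI[where a = "\<lambda>_. 0" and b = "\<lambda>_. 1" and c = "\<lambda>_. 0"])
     (auto simp: case_prod_unfold intro!: derivative_eq_intros)

lemma holomorphic3_on_snd_snd: "holomorphic3_on (\<lambda>z. snd (snd z)) S"
  by (rule holomorphic3_onI[where a = "\<lambda>_. 0" and b = "\<lambda>_. 0" and c = "\<lambda>_. 1"])
     (auto simp: case_prod_unfold intro!: derivative_eq_intros)

lemma holomorphic3_on_diff:
  assumes "holomorphic3_on f S" "holomorphic3_on g S"
  shows "holomorphic3_on (\<lambda>z. f z - g z) S"
  unfolding holomorphic3_on_def
proof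
  fix z assume "z \<in> S"
  then obtain a b c a' b' c' where
    "(f has_derivative (\<lambda>(u, v, w). a * u + b * v + c * w)) (at z within S)"
    "(g has_derivative (\<lambda>(u, v, w). a' * u + b' * v + c' * w)) (at z within S)"
    using assms unfolding holomorphic3_on_def by blast
  from has_derivative_diff[OF this]
  have "((\<lambda>z. f z - g z) has_derivative (\<lambda>(u, v, w). (a - a') * u + (b - b') * v + (c - c') * w))
      (at z within S)"
    by (simp add: case_prod_unfold algebra_simps)
  thus "\<exists>a b c. ((\<lambda>z. f z - g z) has_derivative (\<lambda>(u, v, w). a * u + b * v + c * w)) (at z within S)"
    by blast
qed

lemma holomorphic3_on_mult:
  assumes "holomorphic3_on f S" "holomorphic3_on g S"
  shows "holomorphic3_on (\<lambda>z. f z * g z) S"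
  unfolding holomorphic3_on_def
proof
  fix z assume "z \<in> S"
  then obtain a b c a' b' c' where
    "(f has_derivative (\<lambda>(u, v, w). a * u + b * v + c * w)) (at z within S)"
    "(g has_derivative (\<lambda>(u, v, w). a' * u + b' * v + c' * w)) (at z within S)"
    using assms unfolding holomorphic3_on_def by blast
  from has_derivative_mult[OF this]
  have "((\<lambda>z. f z * g z) has_derivative (\<lambda>(u, v, w).
      (f z * a' + a * g z) * u + (f z * b' + b * g z) * v + (f z * c' + c * g z) * w)) (at z within S)"
    by (simp add: case_prod_unfold algebra_simps)
  thus "\<exists>a b c. ((\<lambda>z. f z * g z) has_derivative (\<lambda>(u, v, w). a * u + b * v + c * w)) (at z within S)"
    by blast
qed

lemma holomorphic3_on_power:
  assumes "holomorphic3_on f S"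
  shows "holomorphic3_on (\<lambda>z. f z ^ n) S"
  by (induction n) (simp_all add: assms holomorphic3_on_const holomorphic3_on_mult)

lemma holomorphic3_on_prod:
  assumes "\<And>i. i \<in> A \<Longrightarrow> holomorphic3_on (f i) S"
  shows "holomorphic3_on (\<lambda>z. \<Prod>i\<in>A. f i z) S"
  using assms
  by (induction A rule: infinite_finite_induct)
     (simp_all add: holomorphic3_on_const holomorphic3_on_mult)

lemma holomorphic3_on_powr_const:
  assumes "holomorphic3_on f S" "\<And>z. z \<in> S \<Longrightarrow> f z \<notin> \<real>\<^sub>\<le>\<^sub>0"
  shows "holomorphic3_on (\<lambda>z. f z powr s) S"
  unfolding holomorphic3_on_def
proof
  fix z assume z: "z \<in> S"
  then obtain a b c where f: "(f has_derivative (\<lambda>(u, v, w). a * u + b * v + c * w)) (at z within S)"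
    using assms unfolding holomorphic3_on_def by blast
  define d where "d = s * f z powr (s - 1)"
  have "((\<lambda>w. w powr s) has_derivative (\<lambda>h. d * h)) (at (f z))"
    using has_field_derivative_powr[OF assms(2)[OF z]]
    unfolding d_def by (simp add: has_field_derivative_def)
  from has_derivative_compose[OF f this]
  have "((\<lambda>z. f z powr s) has_derivative (\<lambda>(u, v, w). (d * a) * u + (d * b) * v + (d * c) * w))
      (at z within S)"
    by (simp add: case_prod_unfold algebra_simps)
  thus "\<exists>a b c. ((\<lambda>z. f z powr s) has_derivative (\<lambda>(u, v, w). a * u + b * v + c * w)) (at z within S)"
    by blast
qed

lemma one_minus_notin_nonpos_Reals:
  fixes z :: complex
  assumes "norm z < 1"
  shows "1 - z \<notin> \<real>\<^sub>\<le>\<^sub>0"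
proof
  assume "1 - z \<in> \<real>\<^sub>\<le>\<^sub>0"
  hence "1 \<le> Re z"
    by (auto simp: complex_nonpos_Reals_iff)
  thus False
    using complex_Re_le_cmod[of z] assms by simp
qed

lemma norm_monomial_less_1:
  fixes k x y t :: complex
  assumes "norm k \<le> 1" "norm x \<le> 1" "norm y \<le> 1" "norm t < 1"
  shows "norm (k * x ^ i * y ^ j * t) < 1"
proof -
  have "norm (k * x ^ i * y ^ j) \<le> 1"
    unfolding norm_mult norm_power using assms by (intro mult_le_one power_le_one) auto
  hence "norm (k * x ^ i * y ^ j) * norm t \<le> norm t"
    by (intro mult_left_le_one_le) auto
  thus ?thesis
    using assms by (simp add: norm_mult)
qed

text \<open>If the factors \<open>k i j\<close>, \<open>x1\<close> and \<open>x2\<close> lie in the closed unit disc, then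
  \<open>1 - k i j * x1 ^ i * x2 ^ j * t\<close> has positive real part for \<open>t\<close> in the open disc, so the
  principal branch is holomorphic there.\<close>

lemma holomorphic_prod_powr:
  assumes "\<And>i j. norm (k i j) \<le> 1" "norm x1 \<le> 1" "norm x2 \<le> 1"
  shows "(\<lambda>t. \<Prod>(i, j)\<in>A. (1 - k i j * x1 ^ i * x2 ^ j * t) powr s i j) holomorphic_on ball 0 1"
  unfolding case_prod_unfold
  by (intro holomorphic_intros one_minus_notin_nonpos_Reals norm_monomial_less_1)
     (use assms in auto)

lemma holomorphic3_prod_powr:
  assumes "\<And>i j. norm (k i j) \<le> 1"
  shows "holomorphic3_on (\<lambda>(x1, x2, t). \<Prod>(i, j)\<in>A. (1 - k i j * x1 ^ i * x2 ^ j * t) powr s i j)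
    (ball 0 1 \<times> ball 0 1 \<times> ball 0 1)"
  unfolding case_prod_unfold
  by (intro holomorphic3_on_prod holomorphic3_on_powr_const holomorphic3_on_diff holomorphic3_on_mult
       holomorphic3_on_power holomorphic3_on_const holomorphic3_on_fst holomorphic3_on_fst_snd
       holomorphic3_on_snd_snd one_minus_notin_nonpos_Reals norm_monomial_less_1)
     (use assms in auto)

section \<open>Averaging over the permutation and over the cycles\<close>

text \<open>The predicate \<open>indep_var\<close> needs two variables with values in the same type, so the
  independence of a permutation and a family of pairs is a statement about the generated
  sigma-algebras.  Functions of the two with a common target type are then independent in the
  usual sense.\<close>

lemma (in prob_space) indep_var_compose_vimage_algebra:
  assumes indep: "indep_set (sets (vimage_algebra (space M) X N)) (sets (vimage_algebra (space M) Y N'))"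
    and [measurable]: "X \<in> measurable M N" "Y \<in> measurable M N'"
      "f \<in> measurable N K" "g \<in> measurable N' K"
  shows "indep_var K (\<lambda>\<omega>. f (X \<omega>)) K (\<lambda>\<omega>. g (Y \<omega>))"
proof -
  have *: "sets (vimage_algebra (space M) (\<lambda>\<omega>. f (X \<omega>)) K) \<subseteq> sets (vimage_algebra (space M) X N)"
    if [measurable]: "X \<in> measurable M N" "f \<in> measurable N K" for X f and N :: "'z measure"
  proof (rule sets_image_in_sets)
    have "X \<in> measurable (vimage_algebra (space M) X N) N"
      using measurable_space[OF that(1)] by (intro measurable_vimage_algebra1) auto
    thus "(\<lambda>\<omega>. f (X \<omega>)) \<in> measurable (vimage_algebra (space M) X N) K"
      using that(2) by (rule measurable_compose)
  qed simp
  have "indep_set (sets (vimage_algebra (space M) (\<lambda>\<omega>. f (X \<omega>)) K))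
      (sets (vimage_algebra (space M) (\<lambda>\<omega>. g (Y \<omega>)) K))"
    using indep *[OF assms(2,4)] *[OF assms(3,5)] unfolding indep_sets2_eq by blast
  thus ?thesis
    unfolding indep_var_eq sets_vimage_algebra by simp
qed

text \<open>If \<open>G\<close> is uniform on \<open>S\<close> and independent of \<open>Y\<close>, then the expectation of \<open>h G Y\<close> is the average
  over \<open>S\<close> of the expectations with \<open>G\<close> held constant.\<close>

lemma (in prob_space) expectation_uniform_indep:
  fixes h :: "'g \<Rightarrow> 'y \<Rightarrow> complex"
  assumes S: "finite S"
    and unif: "distr M (count_space S) G = uniform_count_measure S"
    and G [measurable]: "G \<in> measurable M (count_space S)" and Y: "Y \<in> measurable M N"
    and indep: "indep_set (sets (vimage_algebra (space M) G (count_space S)))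
      (sets (vimage_algebra (space M) Y N))"
    and h: "\<And>g. g \<in> S \<Longrightarrow> h g \<in> borel_measurable N"
    and int: "\<And>g. g \<in> S \<Longrightarrow> integrable M (\<lambda>\<omega>. h g (Y \<omega>))"
  shows "expectation (\<lambda>\<omega>. h (G \<omega>) (Y \<omega>)) = (\<Sum>g\<in>S. expectation (\<lambda>\<omega>. h g (Y \<omega>))) / of_nat (card S)"
proof -
  let ?ind = "\<lambda>g \<omega>. complex_of_real (indicator {g} (G \<omega>))"
  have ind: "indep_var borel (?ind g) borel (\<lambda>\<omega>. h g (Y \<omega>))" if "g \<in> S" for g
    using indep G Y by (rule indep_var_compose_vimage_algebra) (use h that in auto)
  have int_ind: "integrable M (?ind g)" if "g \<in> S" for g
    by (rule integrable_const_bound[where B = 1]) (auto simp: indicator_def)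
  have E: "expectation (?ind g) = 1 / of_nat (card S)" if "g \<in> S" for g
  proof -
    have "expectation (?ind g) = complex_of_real (\<integral>\<omega>. indicator {g} (G \<omega>) \<partial>M)"
      by (rule integral_complex_of_real)
    also have "(\<integral>\<omega>. (indicator {g} (G \<omega>) :: real) \<partial>M) = (\<integral>x. indicator {g} x \<partial>distr M (count_space S) G)"
      by (subst integral_distr) auto
    also have "\<dots> = 1 / card S"
      unfolding unif integral_uniform_count_measure[OF S]
      using S that by (simp add: indicator_def)
    finally show ?thesis by simp
  qed
  have "expectation (\<lambda>\<omega>. h (G \<omega>) (Y \<omega>)) = expectation (\<lambda>\<omega>. \<Sum>g\<in>S. ?ind g \<omega> * h g (Y \<omega>))"
  proof (rule Bochner_Integration.integral_cong[OF refl])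
    fix \<omega> assume "\<omega> \<in> space M"
    hence "G \<omega> \<in> S"
      using measurable_space[OF G] by simp
    have "(\<Sum>g\<in>S. ?ind g \<omega> * h g (Y \<omega>)) = (\<Sum>g\<in>S. if g = G \<omega> then h g (Y \<omega>) else 0)"
      by (intro sum.cong) auto
    thus "h (G \<omega>) (Y \<omega>) = (\<Sum>g\<in>S. ?ind g \<omega> * h g (Y \<omega>))"
      using S \<open>G \<omega> \<in> S\<close> by simp
  qed
  also have "\<dots> = (\<Sum>g\<in>S. expectation (\<lambda>\<omega>. ?ind g \<omega> * h g (Y \<omega>)))"
    using ind int int_ind by (intro Bochner_Integration.integral_sum indep_var_integrable)
  also have "\<dots> = (\<Sum>g\<in>S. 1 / of_nat (card S) * expectation (\<lambda>\<omega>. h g (Y \<omega>)))"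
    using E indep_var_lebesgue_integral[OF ind int_ind int] by (intro sum.cong) auto
  also have "\<dots> = (\<Sum>g\<in>S. expectation (\<lambda>\<omega>. h g (Y \<omega>))) / of_nat (card S)"
    by (simp flip: sum_divide_distrib)
  finally show ?thesis .
qed

lemma uniform_perm_iid_pairsD:
  assumes "uniform_perm_iid_pairs n I \<mu> \<Omega> G Z"
  shows "prob_space \<Omega>"
    and "distr \<Omega> (count_space (Sym n)) G = uniform_count_measure (Sym n)"
    and "prob_space.indep_vars \<Omega> (\<lambda>_. borel) Z I"
    and "i \<in> I \<Longrightarrow> Z i \<in> borel_measurable \<Omega>"
    and "i \<in> I \<Longrightarrow> distr \<Omega> borel (Z i) = \<mu>"
    and "G \<in> measurable \<Omega> (count_space (Sym n))"
    and "(\<lambda>\<omega>. \<lambda>i\<in>I. Z i \<omega>) \<in> measurable \<Omega> (Pi\<^sub>M I (\<lambda>_. borel))"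
    and "prob_space.indep_set \<Omega>
       (sets (vimage_algebra (space \<Omega>) G (count_space (Sym n))))
       (sets (vimage_algebra (space \<Omega>) (\<lambda>\<omega>. \<lambda>i\<in>I. Z i \<omega>) (Pi\<^sub>M I (\<lambda>_. borel))))"
proof -
  show \<Omega>: "prob_space \<Omega>"
    using assms by (simp add: uniform_perm_iid_pairs_def)
  interpret prob_space \<Omega> by fact
  show "distr \<Omega> (count_space (Sym n)) G = uniform_count_measure (Sym n)"
    and Z: "indep_vars (\<lambda>_. borel) Z I"
    and "i \<in> I \<Longrightarrow> distr \<Omega> borel (Z i) = \<mu>"
    and "G \<in> measurable \<Omega> (count_space (Sym n))"
    and "indep_set (sets (vimage_algebra (space \<Omega>) G (count_space (Sym n))))
       (sets (vimage_algebra (space \<Omega>) (\<lambda>\<omega>. \<lambda>i\<in>I. Z i \<omega>) (Pi\<^sub>M I (\<lambda>_. borel))))"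
    using assms by (simp_all add: uniform_perm_iid_pairs_def)
  show meas: "Z i \<in> borel_measurable \<Omega>" if "i \<in> I" for i
    using Z that by (simp add: indep_vars_def)
  show "(\<lambda>\<omega>. \<lambda>i\<in>I. Z i \<omega>) \<in> measurable \<Omega> (Pi\<^sub>M I (\<lambda>_. borel))"
    using meas by (rule measurable_restrict)
qed

text \<open>The common part of both randomizations: \<open>U m j\<close> is the random factor of the \<open>m\<close>-th cycle
  if that cycle has length \<open>j\<close>.  Measurability and integrability aside, all that matters is that
  the factors of different cycles are independent, and that their expectations are the same
  combination of geometric sequences in \<open>j\<close>.\<close>

lemma expectation_random_cycle_product:
  fixes U :: "nat \<Rightarrow> nat \<Rightarrow> ('i \<Rightarrow> complex \<times> complex) \<Rightarrow> complex" and s c :: "'k \<Rightarrow> complex"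
  assumes D: "uniform_perm_iid_pairs n I \<mu> \<Omega> G Z" and A: "finite A"
    and meas: "\<And>m j. m < n \<Longrightarrow> j \<le> n \<Longrightarrow> U m j \<in> borel_measurable (Pi\<^sub>M I (\<lambda>_. borel))"
    and indep: "\<And>k L. k \<le> n \<Longrightarrow> (\<And>m. m < k \<Longrightarrow> L m \<le> n) \<Longrightarrow>
      prob_space.indep_vars \<Omega> (\<lambda>_. borel) (\<lambda>m \<omega>. U m (L m) (\<lambda>i\<in>I. Z i \<omega>)) {..<k}"
    and int: "\<And>m j. m < n \<Longrightarrow> j \<le> n \<Longrightarrow> integrable \<Omega> (\<lambda>\<omega>. U m j (\<lambda>i\<in>I. Z i \<omega>))"
    and E: "\<And>m j. m < n \<Longrightarrow> j \<le> n \<Longrightarrow>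
      (\<integral>\<omega>. U m j (\<lambda>i\<in>I. Z i \<omega>) \<partial>\<Omega>) = (\<Sum>i\<in>A. s i * c i ^ j)"
  shows "(\<integral>\<omega>. (\<Prod>m<length (cycle_type n (G \<omega>)).
      U m (cycle_type n (G \<omega>) ! m) (\<lambda>i\<in>I. Z i \<omega>)) \<partial>\<Omega>) =
    fps_nth (\<Prod>i\<in>A. fps_one_minus_powr (c i) (- s i)) n"
proof -
  note D' = uniform_perm_iid_pairsD[OF D]
  interpret prob_space \<Omega> by (rule D'(1))
  define h where "h = (\<lambda>g z. \<Prod>m<length (cycle_type n g). U m (cycle_type n g ! m) z)"
  have bounds: "m < n" "cycle_type n g ! m \<le> n"
    if "g \<in> Sym n" "m < length (cycle_type n g)" for g m
    using cycle_type_bounds[of g n] that by auto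
  have indep_g: "indep_vars (\<lambda>_. borel) (\<lambda>m \<omega>. U m (cycle_type n g ! m) (\<lambda>i\<in>I. Z i \<omega>))
      {..<length (cycle_type n g)}" if "g \<in> Sym n" for g
    using that cycle_type_bounds[of g n] by (intro indep) auto
  have "expectation (\<lambda>\<omega>. h (G \<omega>) (\<lambda>i\<in>I. Z i \<omega>)) =
      (\<Sum>g\<in>Sym n. expectation (\<lambda>\<omega>. h g (\<lambda>i\<in>I. Z i \<omega>))) / of_nat (card (Sym n))"
  proof (rule expectation_uniform_indep[OF _ D'(2,6,7,8)])
    show "finite (Sym n)"
      by (simp add: finite_permutations)
    show "h g \<in> borel_measurable (Pi\<^sub>M I (\<lambda>_. borel))" if "g \<in> Sym n" for g
      unfolding h_def using that by (intro borel_measurable_prod meas bounds) auto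
    show "integrable \<Omega> (\<lambda>\<omega>. h g (\<lambda>i\<in>I. Z i \<omega>))" if "g \<in> Sym n" for g
      unfolding h_def using that by (intro indep_vars_integrable indep_g int bounds) auto
  qed
  also have "(\<Sum>g\<in>Sym n. expectation (\<lambda>\<omega>. h g (\<lambda>i\<in>I. Z i \<omega>))) =
      (\<Sum>g\<in>Sym n. \<Prod>m<length (cycle_type n g). \<Sum>i\<in>A. s i * c i ^ (cycle_type n g ! m))"
  proof (rule sum.cong[OF refl])
    fix g assume g: "g \<in> Sym n"
    have "expectation (\<lambda>\<omega>. h g (\<lambda>i\<in>I. Z i \<omega>)) =
        (\<Prod>m<length (cycle_type n g). \<integral>\<omega>. U m (cycle_type n g ! m) (\<lambda>i\<in>I. Z i \<omega>) \<partial>\<Omega>)"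
      unfolding h_def using g by (intro indep_vars_lebesgue_integral indep_g int bounds) auto
    also have "\<dots> = (\<Prod>m<length (cycle_type n g). \<Sum>i\<in>A. s i * c i ^ (cycle_type n g ! m))"
      using g by (intro prod.cong refl E bounds) auto
    finally show "expectation (\<lambda>\<omega>. h g (\<lambda>i\<in>I. Z i \<omega>)) =
        (\<Prod>m<length (cycle_type n g). \<Sum>i\<in>A. s i * c i ^ (cycle_type n g ! m))" .
  qed
  also have "\<dots> = fact n * fps_nth (\<Prod>i\<in>A. fps_one_minus_powr (c i) (- s i)) n"
    by (rule sum_cycle_type_geometric[OF A])
  also have "card (Sym n) = fact n"
    by (rule card_permutations) auto
  finally have "expectation (\<lambda>\<omega>. h (G \<omega>) (\<lambda>i\<in>I. Z i \<omega>)) =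
      fps_nth (\<Prod>i\<in>A. fps_one_minus_powr (c i) (- s i)) n"
    by (simp del: restrict_apply)
  thus ?thesis
    unfolding h_def .
qed

section \<open>The two randomized class functions\<close>

lemma borel_measurable_fst_snd [measurable]:
  "fst \<in> borel_measurable (borel :: (complex \<times> complex) measure)"
  "snd \<in> borel_measurable (borel :: (complex \<times> complex) measure)"
  by (intro borel_measurable_continuous_onI continuous_intros)+

lemma borel_measurable_bpoly [measurable]:
  assumes [measurable]: "f \<in> borel_measurable N" "g \<in> borel_measurable N"
  shows "(\<lambda>x. bpoly b (f x) (g x)) \<in> borel_measurable N"
  unfolding bpoly_def case_prod_unfold by measurable

lemma bpoly_scaled_power:
  "bpoly b (x1 ^ j * u) (x2 ^ j * v) =
     (\<Sum>(k1, k2)\<in>coeff_supp b. b k1 k2 * (x1 ^ k1 * x2 ^ k2) ^ j * (u ^ k1 * v ^ k2))"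
  unfolding bpoly_def
  by (intro sum.cong refl) (auto simp: power_mult_distrib mult_ac simp flip: power_mult)

text \<open>A monomial moment of the law passes to each of the identically distributed pairs.\<close>

lemma moment_iid_pair:
  assumes D: "uniform_perm_iid_pairs n I \<mu> \<Omega> G Z" and i: "i \<in> I"
    and int: "integrable \<mu> (\<lambda>p. fst p ^ k1 * snd p ^ k2)"
  shows "integrable \<Omega> (\<lambda>\<omega>. fst (Z i \<omega>) ^ k1 * snd (Z i \<omega>) ^ k2)"
    and "(\<integral>\<omega>. fst (Z i \<omega>) ^ k1 * snd (Z i \<omega>) ^ k2 \<partial>\<Omega>) = (\<integral>p. fst p ^ k1 * snd p ^ k2 \<partial>\<mu>)"
proof -
  have [measurable]: "Z i \<in> borel_measurable \<Omega>" and \<mu>: "\<mu> = distr \<Omega> borel (Z i)"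
    using uniform_perm_iid_pairsD[OF D] i by auto
  show "integrable \<Omega> (\<lambda>\<omega>. fst (Z i \<omega>) ^ k1 * snd (Z i \<omega>) ^ k2)"
    using int unfolding \<mu> by (subst (asm) integrable_distr_eq) auto
  show "(\<integral>\<omega>. fst (Z i \<omega>) ^ k1 * snd (Z i \<omega>) ^ k2 \<partial>\<Omega>) = (\<integral>p. fst p ^ k1 * snd p ^ k2 \<partial>\<mu>)"
    unfolding \<mu> by (subst integral_distr) auto
qed

text \<open>A cycle of length \<open>j\<close> contributes \<open>\<Sum>k1 k2. b k1 k2 * \<alpha> k1 k2 * (x1 ^ k1 * x2 ^ k2) ^ j\<close>: there
  is a single pair for the cycle, so \<open>\<alpha>\<close> occurs as a coefficient.\<close>

lemma expectation_W1:
  assumes D: "uniform_perm_iid_pairs n {..<n} \<mu> \<Omega> G Z"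
    and b: "finite (coeff_supp b)"
    and int: "\<And>k1 k2. integrable \<mu> (\<lambda>p. fst p ^ k1 * snd p ^ k2)"
    and \<alpha>: "\<And>k1 k2. (\<integral>p. fst p ^ k1 * snd p ^ k2 \<partial>\<mu>) = \<alpha> k1 k2"
  shows "(\<integral>\<omega>. W1 b x1 x2 n (G \<omega>) (\<lambda>m. Z m \<omega>) \<partial>\<Omega>) =
    fps_nth (\<Prod>(k1, k2)\<in>coeff_supp b.
      fps_one_minus_powr (x1 ^ k1 * x2 ^ k2) (- (b k1 k2 * \<alpha> k1 k2))) n"
proof -
  note D' = uniform_perm_iid_pairsD[OF D]
  interpret prob_space \<Omega> by (rule D'(1))
  define U where "U = (\<lambda>(m :: nat) (j :: nat) z. bpoly b (x1 ^ j * fst (z m :: complex \<times> complex)) (x2 ^ j * snd (z m)))"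
  have U: "U m j (\<lambda>i\<in>{..<n}. Z i \<omega>) = bpoly b (x1 ^ j * fst (Z m \<omega>)) (x2 ^ j * snd (Z m \<omega>))"
    if "m < n" for m j \<omega>
    using that by (simp add: U_def)
  have "(\<integral>\<omega>. W1 b x1 x2 n (G \<omega>) (\<lambda>m. Z m \<omega>) \<partial>\<Omega>) =
      (\<integral>\<omega>. (\<Prod>m<length (cycle_type n (G \<omega>)).
        U m (cycle_type n (G \<omega>) ! m) (\<lambda>i\<in>{..<n}. Z i \<omega>)) \<partial>\<Omega>)"
  proof (rule Bochner_Integration.integral_cong[OF refl])
    fix \<omega> assume "\<omega> \<in> space \<Omega>"
    hence "G \<omega> permutes {1..n}"
      using measurable_space[OF D'(6)] by simp
    from cycle_type_bounds(1)[OF this]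
    show "W1 b x1 x2 n (G \<omega>) (\<lambda>m. Z m \<omega>) = (\<Prod>m<length (cycle_type n (G \<omega>)).
        U m (cycle_type n (G \<omega>) ! m) (\<lambda>i\<in>{..<n}. Z i \<omega>))"
      unfolding W1_def Let_def by (intro prod.cong refl) (simp add: U mult.commute)
  qed
  also have "\<dots> = fps_nth (\<Prod>k\<in>coeff_supp b. fps_one_minus_powr (x1 ^ fst k * x2 ^ snd k)
      (- (b (fst k) (snd k) * \<alpha> (fst k) (snd k)))) n"
  proof (rule expectation_random_cycle_product[OF D b])
    fix m j assume m: "m < n" and "j \<le> n"
    have [measurable]: "(\<lambda>z. z m) \<in> measurable (Pi\<^sub>M {..<n} (\<lambda>_. borel)) borel"
      using m by (intro measurable_component_singleton) auto
    show "U m j \<in> borel_measurable (Pi\<^sub>M {..<n} (\<lambda>_. borel))"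
      unfolding U_def by measurable
    note moment = moment_iid_pair[OF D _ int, of m]
    show "integrable \<Omega> (\<lambda>\<omega>. U m j (\<lambda>i\<in>{..<n}. Z i \<omega>))"
      unfolding U[OF m] bpoly_scaled_power case_prod_unfold
      using m by (intro Bochner_Integration.integrable_sum integrable_mult_right moment) auto
    have "(\<integral>\<omega>. U m j (\<lambda>i\<in>{..<n}. Z i \<omega>) \<partial>\<Omega>) =
        (\<Sum>k\<in>coeff_supp b. \<integral>\<omega>. b (fst k) (snd k) * (x1 ^ fst k * x2 ^ snd k) ^ j *
          (fst (Z m \<omega>) ^ fst k * snd (Z m \<omega>) ^ snd k) \<partial>\<Omega>)"
      unfolding U[OF m] bpoly_scaled_power case_prod_unfold
      using m by (intro Bochner_Integration.integral_sum integrable_mult_right moment) auto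
    also have "\<dots> = (\<Sum>k\<in>coeff_supp b.
        b (fst k) (snd k) * \<alpha> (fst k) (snd k) * (x1 ^ fst k * x2 ^ snd k) ^ j)"
      using m moment(2) by (intro sum.cong refl) (simp add: \<alpha>)
    finally show "(\<integral>\<omega>. U m j (\<lambda>i\<in>{..<n}. Z i \<omega>) \<partial>\<Omega>) =
        (\<Sum>k\<in>coeff_supp b. b (fst k) (snd k) * \<alpha> (fst k) (snd k) * (x1 ^ fst k * x2 ^ snd k) ^ j)" .
  next
    fix k and L :: "nat \<Rightarrow> nat" assume k: "k \<le> n"
    have "indep_vars (\<lambda>_. borel) Z {..<k}"
      using D'(3) by (rule indep_vars_subset) (use k in auto)
    hence "indep_vars (\<lambda>_. borel)
        (\<lambda>m \<omega>. bpoly b (x1 ^ L m * fst (Z m \<omega>)) (x2 ^ L m * snd (Z m \<omega>))) {..<k}"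
      by (rule indep_vars_compose2) measurable
    also have "?this \<longleftrightarrow> indep_vars (\<lambda>_. borel) (\<lambda>m \<omega>. U m (L m) (\<lambda>i\<in>{..<n}. Z i \<omega>)) {..<k}"
      using k by (intro indep_vars_cong refl) (auto simp: U)
    finally show "indep_vars (\<lambda>_. borel) (\<lambda>m \<omega>. U m (L m) (\<lambda>i\<in>{..<n}. Z i \<omega>)) {..<k}" .
  qed
  finally show ?thesis
    by (simp add: case_prod_unfold)
qed

text \<open>Here a cycle of length \<open>j\<close> contributes \<open>\<Sum>k1 k2. b k1 k2 * (\<alpha> k1 k2 * x1 ^ k1 * x2 ^ k2) ^ j\<close>:
  there are \<open>j\<close> independent pairs for the cycle, so \<open>\<alpha>\<close> occurs inside the power.\<close>

lemma expectation_W2: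
  assumes D: "uniform_perm_iid_pairs n ({..<n} \<times> {..<n}) \<mu> \<Omega> G Z"
    and b: "finite (coeff_supp b)"
    and int: "\<And>k1 k2. integrable \<mu> (\<lambda>p. fst p ^ k1 * snd p ^ k2)"
    and \<alpha>: "\<And>k1 k2. (\<integral>p. fst p ^ k1 * snd p ^ k2 \<partial>\<mu>) = \<alpha> k1 k2"
  shows "(\<integral>\<omega>. W2 b x1 x2 n (G \<omega>) (\<lambda>mi. Z mi \<omega>) \<partial>\<Omega>) =
    fps_nth (\<Prod>(k1, k2)\<in>coeff_supp b.
      fps_one_minus_powr (\<alpha> k1 k2 * x1 ^ k1 * x2 ^ k2) (- b k1 k2)) n"
proof -
  note D' = uniform_perm_iid_pairsD[OF D]
  interpret prob_space \<Omega> by (rule D'(1))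
  let ?I = "{..<n} \<times> {..<n}"
  define U where "U = (\<lambda>(m :: nat) (j :: nat) z. bpoly b
    (x1 ^ j * (\<Prod>i<j. fst (z (m, i) :: complex \<times> complex))) (x2 ^ j * (\<Prod>i<j. snd (z (m, i)))))"
  have U_restrict: "U m j (restrict z J) = U m j z" if "{m} \<times> {..<j} \<subseteq> J"
    for m j z and J :: "(nat \<times> nat) set"
  proof -
    have "restrict z J (m, i) = z (m, i)" if "i < j" for i
      using that \<open>{m} \<times> {..<j} \<subseteq> J\<close> by auto
    thus ?thesis
      by (simp add: U_def)
  qed
  have U_meas: "U m j \<in> borel_measurable (Pi\<^sub>M J (\<lambda>_. borel))" if "{m} \<times> {..<j} \<subseteq> J"
    for m j and J :: "(nat \<times> nat) set"
  proof -
    have [measurable]: "(\<lambda>z. z (m, i)) \<in> measurable (Pi\<^sub>M J (\<lambda>_. borel)) borel" if "i \<in> {..<j}" for i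
      using that \<open>{m} \<times> {..<j} \<subseteq> J\<close> by (intro measurable_component_singleton) auto
    show ?thesis
      unfolding U_def by measurable
  qed
  have U: "U m j (\<lambda>i\<in>?I. Z i \<omega>) = (\<Sum>k\<in>coeff_supp b. b (fst k) (snd k) * (x1 ^ fst k * x2 ^ snd k) ^ j *
      (\<Prod>i<j. fst (Z (m, i) \<omega>) ^ fst k * snd (Z (m, i) \<omega>) ^ snd k))"
    if "m < n" "j \<le> n" for m j \<omega>
  proof -
    have "U m j (\<lambda>i\<in>?I. Z i \<omega>) = U m j (\<lambda>i. Z i \<omega>)"
      using that by (intro U_restrict) auto
    thus ?thesis
      unfolding U_def bpoly_scaled_power by (simp add: case_prod_unfold prod_power_distrib prod.distrib)
  qed
  have "(\<integral>\<omega>. W2 b x1 x2 n (G \<omega>) (\<lambda>mi. Z mi \<omega>) \<partial>\<Omega>) =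
      (\<integral>\<omega>. (\<Prod>m<length (cycle_type n (G \<omega>)).
        U m (cycle_type n (G \<omega>) ! m) (\<lambda>i\<in>?I. Z i \<omega>)) \<partial>\<Omega>)"
  proof (rule Bochner_Integration.integral_cong[OF refl])
    fix \<omega> assume "\<omega> \<in> space \<Omega>"
    hence "G \<omega> permutes {1..n}"
      using measurable_space[OF D'(6)] by simp
    note bounds = cycle_type_bounds[OF this]
    have "W2 b x1 x2 n (G \<omega>) (\<lambda>mi. Z mi \<omega>) =
        (\<Prod>m<length (cycle_type n (G \<omega>)). U m (cycle_type n (G \<omega>) ! m) (\<lambda>i. Z i \<omega>))"
      by (simp add: W2_def Let_def U_def)
    also have "\<dots> = (\<Prod>m<length (cycle_type n (G \<omega>)).
        U m (cycle_type n (G \<omega>) ! m) (\<lambda>i\<in>?I. Z i \<omega>))"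
      using bounds by (intro prod.cong refl U_restrict[symmetric]) fastforce
    finally show "W2 b x1 x2 n (G \<omega>) (\<lambda>mi. Z mi \<omega>) = (\<Prod>m<length (cycle_type n (G \<omega>)).
        U m (cycle_type n (G \<omega>) ! m) (\<lambda>i\<in>?I. Z i \<omega>))" .
  qed
  also have "\<dots> = fps_nth (\<Prod>k\<in>coeff_supp b.
      fps_one_minus_powr (\<alpha> (fst k) (snd k) * x1 ^ fst k * x2 ^ snd k) (- b (fst k) (snd k))) n"
  proof (rule expectation_random_cycle_product[OF D b])
    fix m j assume m: "m < n" and j: "j \<le> n"
    show "U m j \<in> borel_measurable (Pi\<^sub>M ?I (\<lambda>_. borel))"
      using m j by (intro U_meas) auto
    have indep: "indep_vars (\<lambda>_. borel)
        (\<lambda>i \<omega>. fst (Z (m, i) \<omega>) ^ k1 * snd (Z (m, i) \<omega>) ^ k2) {..<j}" for k1 k2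
    proof -
      \<comment> \<open>Restricting to singleton blocks re-indexes the family by \<open>i\<close> alone.\<close>
      have "indep_vars (\<lambda>i. Pi\<^sub>M {(m, i)} (\<lambda>_. borel)) (\<lambda>i \<omega>. restrict (\<lambda>i. Z i \<omega>) {(m, i)}) {..<j}"
        using D'(3) by (rule indep_vars_restrict) (use m j in \<open>auto simp: disjoint_family_on_def\<close>)
      hence "indep_vars (\<lambda>_. borel) (\<lambda>i \<omega>. (\<lambda>z. fst (z (m, i)) ^ k1 * snd (z (m, i)) ^ k2)
          (restrict (\<lambda>i. Z i \<omega>) {(m, i)})) {..<j}"
      proof (rule indep_vars_compose2)
        fix i
        have [measurable]: "(\<lambda>z. z (m, i)) \<in> measurable (Pi\<^sub>M {(m, i)} (\<lambda>_. borel)) borel"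
          by (intro measurable_component_singleton) auto
        show "(\<lambda>z. fst (z (m, i)) ^ k1 * snd (z (m, i)) ^ k2 :: complex)
            \<in> borel_measurable (Pi\<^sub>M {(m, i)} (\<lambda>_. borel))"
          by measurable
      qed
      thus ?thesis by simp
    qed
    note moment = moment_iid_pair[OF D _ int]
    have int_prod: "integrable \<Omega> (\<lambda>\<omega>. \<Prod>i<j. fst (Z (m, i) \<omega>) ^ k1 * snd (Z (m, i) \<omega>) ^ k2)" for k1 k2
      using m j by (intro indep_vars_integrable indep moment) auto
    have E_prod: "expectation (\<lambda>\<omega>. \<Prod>i<j. fst (Z (m, i) \<omega>) ^ k1 * snd (Z (m, i) \<omega>) ^ k2) =
        \<alpha> k1 k2 ^ j" for k1 k2
    proof -
      have "expectation (\<lambda>\<omega>. \<Prod>i<j. fst (Z (m, i) \<omega>) ^ k1 * snd (Z (m, i) \<omega>) ^ k2) =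
          (\<Prod>i<j. expectation (\<lambda>\<omega>. fst (Z (m, i) \<omega>) ^ k1 * snd (Z (m, i) \<omega>) ^ k2))"
        using m j by (intro indep_vars_lebesgue_integral indep moment) auto
      also have "\<dots> = (\<Prod>i<j. \<alpha> k1 k2)"
        using m j moment(2) by (intro prod.cong) (auto simp: \<alpha>)
      finally show ?thesis by simp
    qed
    show "integrable \<Omega> (\<lambda>\<omega>. U m j (\<lambda>i\<in>?I. Z i \<omega>))"
      unfolding U[OF m j]
      by (intro Bochner_Integration.integrable_sum integrable_mult_right int_prod)
    show "(\<integral>\<omega>. U m j (\<lambda>i\<in>?I. Z i \<omega>) \<partial>\<Omega>) =
        (\<Sum>k\<in>coeff_supp b. b (fst k) (snd k) * (\<alpha> (fst k) (snd k) * x1 ^ fst k * x2 ^ snd k) ^ j)"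
      unfolding U[OF m j] using int_prod E_prod
      by (simp add: Bochner_Integration.integral_sum power_mult_distrib mult_ac)
  next
    fix k and L :: "nat \<Rightarrow> nat" assume k: "k \<le> n" and L: "\<And>m. m < k \<Longrightarrow> L m \<le> n"
    \<comment> \<open>Different cycles read disjoint blocks of indices.\<close>
    let ?K = "\<lambda>m. {m} \<times> {..<L m}"
    have sub: "?K m \<subseteq> ?I" if "m \<in> {..<k}" for m
      using that k L[of m] by fastforce
    have "indep_vars (\<lambda>m. Pi\<^sub>M (?K m) (\<lambda>_. borel)) (\<lambda>m \<omega>. restrict (\<lambda>i. Z i \<omega>) (?K m)) {..<k}"
      using D'(3) sub by (rule indep_vars_restrict) (auto simp: disjoint_family_on_def)
    hence "indep_vars (\<lambda>_. borel) (\<lambda>m \<omega>. U m (L m) (restrict (\<lambda>i. Z i \<omega>) (?K m))) {..<k}"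
      by (rule indep_vars_compose2) (intro U_meas order_refl)
    also have "?this \<longleftrightarrow> indep_vars (\<lambda>_. borel) (\<lambda>m \<omega>. U m (L m) (\<lambda>i\<in>?I. Z i \<omega>)) {..<k}"
      using sub by (intro indep_vars_cong refl ext) (simp only: U_restrict order_refl)
    finally show "indep_vars (\<lambda>_. borel) (\<lambda>m \<omega>. U m (L m) (\<lambda>i\<in>?I. Z i \<omega>)) {..<k}" .
  qed
  finally show ?thesis
    by (simp add: case_prod_unfold)
qed

text \<open>The moments of a law on the torus exist and lie in the closed unit disc.\<close>

lemma torus_moments:
  fixes \<theta> \<phi> :: "'a \<Rightarrow> complex"
  assumes "prob_space M"
    and [measurable]: "\<theta> \<in> borel_measurable M" "\<phi> \<in> borel_measurable M"
    and "\<And>\<omega>. \<omega> \<in> space M \<Longrightarrow> \<theta> \<omega> \<in> sphere 0 1" "\<And>\<omega>. \<omega> \<in> space M \<Longrightarrow> \<phi> \<omega> \<in> sphere 0 1"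
  defines "\<mu> \<equiv> distr M borel (\<lambda>\<omega>. (\<theta> \<omega>, \<phi> \<omega>))"
  shows "integrable \<mu> (\<lambda>p. fst p ^ k1 * snd p ^ k2)"
    and "(\<integral>p. fst p ^ k1 * snd p ^ k2 \<partial>\<mu>) = (\<integral>\<omega>. \<theta> \<omega> ^ k1 * \<phi> \<omega> ^ k2 \<partial>M)"
    and "norm (\<integral>\<omega>. \<theta> \<omega> ^ k1 * \<phi> \<omega> ^ k2 \<partial>M) \<le> 1"
proof -
  interpret prob_space M by fact
  have norm: "norm (\<theta> \<omega> ^ k1 * \<phi> \<omega> ^ k2) = 1" if "\<omega> \<in> space M" for \<omega>
    using assms(4,5)[OF that] by (simp add: norm_mult norm_power)
  have int: "integrable M (\<lambda>\<omega>. \<theta> \<omega> ^ k1 * \<phi> \<omega> ^ k2)"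
    by (rule integrable_const_bound[where B = 1]) (use norm in auto)
  have [measurable]: "(\<lambda>\<omega>. (\<theta> \<omega>, \<phi> \<omega>)) \<in> borel_measurable M"
    by (intro borel_measurable_Pair) auto
  show "integrable \<mu> (\<lambda>p. fst p ^ k1 * snd p ^ k2)"
    unfolding \<mu>_def using int by (subst integrable_distr_eq) auto
  show "(\<integral>p. fst p ^ k1 * snd p ^ k2 \<partial>\<mu>) = (\<integral>\<omega>. \<theta> \<omega> ^ k1 * \<phi> \<omega> ^ k2 \<partial>M)"
    unfolding \<mu>_def by (subst integral_distr) auto
  have "norm (\<integral>\<omega>. \<theta> \<omega> ^ k1 * \<phi> \<omega> ^ k2 \<partial>M) \<le> (\<integral>\<omega>. norm (\<theta> \<omega> ^ k1 * \<phi> \<omega> ^ k2) \<partial>M)"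
    by (rule integral_norm_bound)
  also have "\<dots> = (\<integral>\<omega>. 1 \<partial>M)"
    by (rule Bochner_Integration.integral_cong) (use norm in auto)
  finally show "norm (\<integral>\<omega>. \<theta> \<omega> ^ k1 * \<phi> \<omega> ^ k2 \<partial>M) \<le> 1"
    by (simp add: prob_space)
qed

theorem theorem4p6:
  fixes M :: "'a measure" and \<theta> \<phi> :: "'a \<Rightarrow> complex"
    and b \<alpha> :: "nat \<Rightarrow> nat \<Rightarrow> complex"
    and \<mu> :: "(complex \<times> complex) measure"
    and F1 F2 :: "complex \<Rightarrow> complex \<Rightarrow> complex \<Rightarrow> complex"
  assumes "prob_space M"
    and "\<theta> \<in> borel_measurable M" and "\<phi> \<in> borel_measurable M"
    and "\<And>\<omega>. \<omega> \<in> space M \<Longrightarrow> \<theta> \<omega> \<in> sphere 0 1"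
    and "\<And>\<omega>. \<omega> \<in> space M \<Longrightarrow> \<phi> \<omega> \<in> sphere 0 1"
    and "finite (coeff_supp b)"
  defines "\<mu> \<equiv> distr M borel (\<lambda>\<omega>. (\<theta> \<omega>, \<phi> \<omega>))"
    and "\<alpha> \<equiv> (\<lambda>k1 k2. \<integral>\<omega>. \<theta> \<omega> ^ k1 * \<phi> \<omega> ^ k2 \<partial>M)"
    and "F1 \<equiv> (\<lambda>x1 x2 t. \<Prod>(k1, k2)\<in>coeff_supp b.
           (1 - x1 ^ k1 * x2 ^ k2 * t) powr (- (b k1 k2 * \<alpha> k1 k2)))"
    and "F2 \<equiv> (\<lambda>x1 x2 t. \<Prod>(k1, k2)\<in>coeff_supp b.
           (1 - \<alpha> k1 k2 * x1 ^ k1 * x2 ^ k2 * t) powr (- b k1 k2))"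
  shows
    "(\<forall>n x1 x2 (\<Omega> :: 'b measure) G Z.
        uniform_perm_iid_pairs n {..<n} \<mu> \<Omega> G Z \<longrightarrow>
        (\<integral>\<omega>. W1 b x1 x2 n (G \<omega>) (\<lambda>m. Z m \<omega>) \<partial>\<Omega>) =
          fps_nth (\<Prod>(k1, k2)\<in>coeff_supp b.
            fps_one_minus_powr (x1 ^ k1 * x2 ^ k2) (- (b k1 k2 * \<alpha> k1 k2))) n) \<and>
     (\<forall>n x1 x2 (\<Omega> :: 'c measure) G Z.
        uniform_perm_iid_pairs n ({..<n} \<times> {..<n}) \<mu> \<Omega> G Z \<longrightarrow>
        (\<integral>\<omega>. W2 b x1 x2 n (G \<omega>) (\<lambda>mi. Z mi \<omega>) \<partial>\<Omega>) =
          fps_nth (\<Prod>(k1, k2)\<in>coeff_supp b.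
            fps_one_minus_powr (\<alpha> k1 k2 * x1 ^ k1 * x2 ^ k2) (- b k1 k2)) n) \<and>
     (\<forall>x1 x2. max (norm x1) (norm x2) \<le> 1 \<longrightarrow>
        F1 x1 x2 holomorphic_on ball 0 1 \<and> F2 x1 x2 holomorphic_on ball 0 1) \<and>
     holomorphic3_on (\<lambda>(x1, x2, t). F1 x1 x2 t) (ball 0 1 \<times> ball 0 1 \<times> ball 0 1) \<and>
     holomorphic3_on (\<lambda>(x1, x2, t). F2 x1 x2 t) (ball 0 1 \<times> ball 0 1 \<times> ball 0 1)"
proof (intro conjI allI impI)
  note \<mu>_moments = torus_moments[OF assms(1-5), folded \<mu>_def]
  have \<alpha>: "(\<integral>p. fst p ^ k1 * snd p ^ k2 \<partial>\<mu>) = \<alpha> k1 k2" for k1 k2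
    unfolding \<alpha>_def by (rule \<mu>_moments(2))
  have norm_\<alpha>: "norm (\<alpha> k1 k2) \<le> 1" for k1 k2
    unfolding \<alpha>_def by (rule \<mu>_moments(3))
  {
    fix n x1 x2 and \<Omega> :: "'b measure" and G Z
    assume "uniform_perm_iid_pairs n {..<n} \<mu> \<Omega> G Z"
    thus "(\<integral>\<omega>. W1 b x1 x2 n (G \<omega>) (\<lambda>m. Z m \<omega>) \<partial>\<Omega>) =
        fps_nth (\<Prod>(k1, k2)\<in>coeff_supp b.
          fps_one_minus_powr (x1 ^ k1 * x2 ^ k2) (- (b k1 k2 * \<alpha> k1 k2))) n"
      using assms(6) \<mu>_moments(1) \<alpha> by (rule expectation_W1)
  next
    fix n x1 x2 and \<Omega> :: "'c measure" and G Z
    assume "uniform_perm_iid_pairs n ({..<n} \<times> {..<n}) \<mu> \<Omega> G Z"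
    thus "(\<integral>\<omega>. W2 b x1 x2 n (G \<omega>) (\<lambda>mi. Z mi \<omega>) \<partial>\<Omega>) =
        fps_nth (\<Prod>(k1, k2)\<in>coeff_supp b.
          fps_one_minus_powr (\<alpha> k1 k2 * x1 ^ k1 * x2 ^ k2) (- b k1 k2)) n"
      using assms(6) \<mu>_moments(1) \<alpha> by (rule expectation_W2)
  next
    fix x1 x2 :: complex assume "max (norm x1) (norm x2) \<le> 1"
    hence x: "norm x1 \<le> 1" "norm x2 \<le> 1"
      by auto
    show "F1 x1 x2 holomorphic_on ball 0 1"
      unfolding F1_def using holomorphic_prod_powr[of "\<lambda>_ _. 1", OF _ x] by simp
    show "F2 x1 x2 holomorphic_on ball 0 1"
      unfolding F2_def using norm_\<alpha> x by (rule holomorphic_prod_powr)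
  next
    show "holomorphic3_on (\<lambda>(x1, x2, t). F1 x1 x2 t) (ball 0 1 \<times> ball 0 1 \<times> ball 0 1)"
      unfolding F1_def using holomorphic3_prod_powr[of "\<lambda>_ _. 1"] by simp
    show "holomorphic3_on (\<lambda>(x1, x2, t). F2 x1 x2 t) (ball 0 1 \<times> ball 0 1 \<times> ball 0 1)"
      unfolding F2_def using norm_\<alpha> by (rule holomorphic3_prod_powr)
  }
qed

end
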